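(* Let $M=\mathbb{R}^2$ with coordinates $(t,x)$, equipped with the Lorentzian metric \[ g=-\cos(2\varphi)\,(dt)^2+2\sin(2\varphi)\,dt\,dx+\cos(2\varphi)\,(dx)^2,\qquad \varphi=\pi x . \] For each $k\in\mathbb{Z}$ define the stationary stripe \[ M_k:=\left\{(t,x)\in M:\ k-\tfrac14<x<k+\tfrac14\right\}. \] Then $\partial_t$ is a Killing field of $g$ and is timelike on each $M_k$. Let the time orientation of $(M,g)$ be the one induced by the global timelike vector field \[ V=(\cos\varphi)\,\partial_t-(\sin\varphi)\,\partial_x . \] With respect to this time orientation, the null boundary components of the stationary stripes are one-way causal barriers, in the following precise sense: for every $k\in\mathbb{Z}$, every future-directed causal curve which enters the even stationary stripe $M_{2k}$ cannot leave it, whereas no future-directed causal curve can enter the odd stationary stripe $M_{2k-1}$.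
   Context: The signature convention is $(-,+)$: a nonzero tangent vector $u$ is timelike if $g(u,u)<0$, null if $g(u,u)=0$, and causal if $g(u,u)\le 0$. A nonzero causal vector $u$ is future-directed (with respect to the time orientation induced by $V$) if $g(V,u)\le 0$. A future-directed causal curve is a (smooth) curve whose tangent vector is everywhere nonzero, causal and future-directed. The boundary components of $M_k$ are the lines $\{x=k-\frac14\}$ and $\{x=k+\frac14\}$. "A future-directed causal curve $\gamma$ which enters a stripe cannot leave it" means: if $\gamma(s_0)$ lies in the stripe, then $\gamma(s)$ lies in the stripe for all parameters $s\ge s_0$ in the domain of $\gamma$. "No future-directed causal curve can enter a stripe" means: if $\gamma(s_0)$ does not lie in the stripe, then $\gamma(s)$ does not lie in the stripe for all parameters $s\ge s_0$ in the domain of $\gamma$. *)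

theory Defs
  imports "HOL-Analysis.Analysis"
begin

text \<open>
  Points of the plane are pairs \<open>(t, x)\<close>. The tangent space at every point is identified with
  \<open>real \<times> real\<close> through the coordinate frame, so that \<open>(a, b)\<close> stands for
  \<open>a \<partial>\<^sub>t + b \<partial>\<^sub>x\<close>.
\<close>

type_synonym point = "real \<times> real"
type_synonym tangent = "real \<times> real"
type_synonym vector_field = "point \<Rightarrow> tangent"
type_synonym tensor2 = "point \<Rightarrow> tangent \<Rightarrow> tangent \<Rightarrow> real"

fun Ck :: "nat \<Rightarrow> ('a::real_normed_vector \<Rightarrow> 'b::real_normed_vector) \<Rightarrow> bool" where
  "Ck 0 f \<longleftrightarrow> continuous_on UNIV f"
| "Ck (Suc n) f \<longleftrightarrow>
     (\<forall>p. f differentiable (at p)) \<and> (\<forall>v. Ck n (\<lambda>p. frechet_derivative f (at p) v))"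

definition smooth :: "('a::real_normed_vector \<Rightarrow> 'b::real_normed_vector) \<Rightarrow> bool" where
  "smooth f \<longleftrightarrow> (\<forall>n. Ck n f)"

text \<open>
  In the two-dimensional case an orthonormal pair for a bilinear form with values \<open>-1, 1\<close>
  is automatically a basis, so the third conjunct below says that the signature is \<open>(-,+)\<close>.
\<close>

definition lorentzian_metric :: "tensor2 \<Rightarrow> bool" where
  "lorentzian_metric g \<longleftrightarrow>
     (\<forall>p. bilinear (g p) \<and> (\<forall>u v. g p u v = g p v u)) \<and>
     (\<forall>u v. smooth (\<lambda>p. g p u v)) \<and>
     (\<forall>p. \<exists>e0 e1. g p e0 e0 = -1 \<and> g p e1 e1 = 1 \<and> g p e0 e1 = 0)"

definition timelike :: "tensor2 \<Rightarrow> point \<Rightarrow> tangent \<Rightarrow> bool" where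
  "timelike g p u \<longleftrightarrow> u \<noteq> 0 \<and> g p u u < 0"

definition null :: "tensor2 \<Rightarrow> point \<Rightarrow> tangent \<Rightarrow> bool" where
  "null g p u \<longleftrightarrow> u \<noteq> 0 \<and> g p u u = 0"

definition causal :: "tensor2 \<Rightarrow> point \<Rightarrow> tangent \<Rightarrow> bool" where
  "causal g p u \<longleftrightarrow> u \<noteq> 0 \<and> g p u u \<le> 0"

definition future_directed :: "tensor2 \<Rightarrow> vector_field \<Rightarrow> point \<Rightarrow> tangent \<Rightarrow> bool" where
  "future_directed g V p u \<longleftrightarrow> causal g p u \<and> g p (V p) u \<le> 0"

text \<open>
  The Lie derivative of a covariant 2-tensor, in coordinates
  \<open>(L\<^sub>K g)(u, v) = K\<^sup>l (\<partial>\<^sub>l g\<^sub>i\<^sub>j) u\<^sup>i v\<^sup>j + g\<^sub>l\<^sub>j (\<partial>\<^sub>i K\<^sup>l) u\<^sup>i v\<^sup>j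
  + g\<^sub>i\<^sub>l (\<partial>\<^sub>j K\<^sup>l) u\<^sup>i v\<^sup>j\<close>.
\<close>

definition lie_derivative :: "vector_field \<Rightarrow> tensor2 \<Rightarrow> tensor2" where
  "lie_derivative K g p u v =
     frechet_derivative (\<lambda>q. g q u v) (at p) (K p)
     + g p (frechet_derivative K (at p) u) v
     + g p u (frechet_derivative K (at p) v)"

definition killing_field :: "tensor2 \<Rightarrow> vector_field \<Rightarrow> bool" where
  "killing_field g K \<longleftrightarrow> smooth K \<and> (\<forall>p u v. lie_derivative K g p u v = 0)"

text \<open>
  Smoothness of a curve on an arbitrary interval; derivatives at endpoints belonging to the
  interval are one-sided.
\<close>

fun curve_Ck :: "nat \<Rightarrow> real set \<Rightarrow> (real \<Rightarrow> 'a::real_normed_vector) \<Rightarrow> bool" where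
  "curve_Ck 0 I c \<longleftrightarrow> continuous_on I c"
| "curve_Ck (Suc n) I c \<longleftrightarrow>
     (\<forall>s\<in>I. c differentiable (at s within I)) \<and>
     curve_Ck n I (\<lambda>s. vector_derivative c (at s within I))"

definition smooth_curve :: "real set \<Rightarrow> (real \<Rightarrow> 'a::real_normed_vector) \<Rightarrow> bool" where
  "smooth_curve I c \<longleftrightarrow> is_interval I \<and> interior I \<noteq> {} \<and> (\<forall>n. curve_Ck n I c)"

definition future_directed_causal_curve ::
    "tensor2 \<Rightarrow> vector_field \<Rightarrow> real set \<Rightarrow> (real \<Rightarrow> point) \<Rightarrow> bool" where
  "future_directed_causal_curve g V I \<gamma> \<longleftrightarrow>
     smooth_curve I \<gamma> \<and>
     (\<forall>s\<in>I. future_directed g V (\<gamma> s) (vector_derivative \<gamma> (at s within I)))"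

definition tangent_to :: "point set \<Rightarrow> point \<Rightarrow> tangent \<Rightarrow> bool" where
  "tangent_to N p u \<longleftrightarrow>
     (\<exists>c. smooth_curve UNIV c \<and> range c \<subseteq> N \<and> c 0 = p \<and> (c has_vector_derivative u) (at 0))"

text \<open>
  To be applied to one-dimensional submanifolds, where degeneracy of the induced metric
  amounts to the nonzero tangent vectors being null.
\<close>

definition null_line :: "tensor2 \<Rightarrow> point set \<Rightarrow> bool" where
  "null_line g N \<longleftrightarrow> (\<forall>p\<in>N. \<forall>u. tangent_to N p u \<and> u \<noteq> 0 \<longrightarrow> null g p u)"

definition phi :: "point \<Rightarrow> real" where
  "phi p = pi * snd p"

definition metric_g :: tensor2 where
  "metric_g p u v =
     - cos (2 * phi p) * (fst u * fst v)
     + sin (2 * phi p) * (fst u * snd v + snd u * fst v)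
     + cos (2 * phi p) * (snd u * snd v)"

definition d_t :: vector_field where
  "d_t p = (1, 0)"

definition d_x :: vector_field where
  "d_x p = (0, 1)"

definition field_V :: vector_field where
  "field_V p = cos (phi p) *\<^sub>R d_t p - sin (phi p) *\<^sub>R d_x p"

definition stripe :: "int \<Rightarrow> point set" where
  "stripe k = {(t, x). of_int k - 1/4 < x \<and> x < of_int k + 1/4}"

definition vertical_line :: "real \<Rightarrow> point set" where
  "vertical_line c = {(t, x). x = c}"

end

theory Submission
  imports Defs
begin

text \<open>
  Rotating a tangent vector by the angle \<open>\<phi>\<close> turns \<open>g\<close> into the Minkowski form
  \<open>q\<^sup>2 - p\<^sup>2\<close> and \<open>V\<close> into \<open>(1, 0)\<close>, so that the future-directed causal vectors are
  given by \<open>\<bar>q\<bar> \<le> p\<close>. On a boundary line \<open>x = c\<close> of a stripe this cone lies on one side of the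
  line, and near it the velocity in the forbidden direction is at most \<open>\<pi> \<bar>x - c\<bar>\<close> times the
  speed. Gronwall's inequality then shows that the line is neither crossed nor reached in the
  forbidden direction.
\<close>

section \<open>A one-sided Gronwall inequality\<close>

text \<open>Let \<open>z\<close> be the last time at which \<open>f\<close> is nonpositive. After it
  \<open>f\<close> is positive, so the bound reads f' \<le> K f, and f times the integrating factor
  exp(-K s) cannot increase from its nonpositive value at \<open>z\<close>.\<close>

lemma nonpos_persists:
  fixes f f' :: "real \<Rightarrow> real"
  assumes "a \<le> b"
    and der: "\<And>s. s \<in> {a..b} \<Longrightarrow> (f has_vector_derivative f' s) (at s within {a..b})"
    and bound: "\<And>s. s \<in> {a..b} \<Longrightarrow> f' s \<le> K * \<bar>f s\<bar>"
    and "f a \<le> 0"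
  shows "f b \<le> 0"
proof (rule ccontr)
  assume fb: "\<not> f b \<le> 0"
  have cont: "continuous_on {a..b} f"
    unfolding continuous_on_eq_continuous_within
    using der has_vector_derivative_continuous by blast
  define Z where "Z = {s \<in> {a..b}. f s \<le> 0}"
  have "closed Z"
    unfolding Z_def by (rule continuous_on_closed_Collect_le[OF cont]) auto
  moreover have "bounded Z"
    by (rule bounded_subset[OF bounded_closed_interval[of a b]]) (auto simp: Z_def)
  ultimately have "compact Z"
    by (simp add: compact_eq_bounded_closed)
  moreover have "a \<in> Z"
    using assms by (simp add: Z_def)
  ultimately obtain z where z: "z \<in> Z" "\<And>s. s \<in> Z \<Longrightarrow> s \<le> z"
    using compact_attains_sup[of Z] by blast
  have zb: "a \<le> z" "z \<le> b" "f z \<le> 0"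
    using z by (auto simp: Z_def)
  have pos: "f s > 0" if "z < s" "s \<le> b" for s
    using z(2)[of s] that zb by (force simp: Z_def)
  have "exp (- K * b) * f b \<le> exp (- K * z) * f z"
  proof (rule DERIV_nonpos_imp_decreasing_open[of z b "\<lambda>s. exp (- K * s) * f s"])
    show "continuous_on {z..b} (\<lambda>s. exp (- K * s) * f s)"
      using zb by (intro continuous_intros continuous_on_subset[OF cont]) auto
    fix s assume s: "z < s" "s < b"
    then have sI: "s \<in> {a..b}"
      using zb by auto
    have "at s within {a..b} = at s"
      using s zb by (intro at_within_interior) auto
    then have "(f has_real_derivative f' s) (at s)"
      using der[OF sI] by (simp add: has_real_derivative_iff_has_vector_derivative)
    then have "((\<lambda>s. exp (- K * s) * f s) has_real_derivative exp (- K * s) * (f' s - K * f s)) (at s)"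
      by (auto intro!: derivative_eq_intros simp: algebra_simps)
    moreover have "f' s - K * f s \<le> 0"
      using bound[OF sI] pos[of s] s by simp
    ultimately show "\<exists>y. ((\<lambda>s. exp (- K * s) * f s) has_real_derivative y) (at s) \<and> y \<le> 0"
      by (meson exp_ge_zero mult_nonneg_nonpos)
  qed (use zb in auto)
  moreover have "exp (- K * z) * f z \<le> 0"
    using zb by (simp add: mult_nonneg_nonpos)
  ultimately have "exp (- K * b) * f b \<le> 0"
    by simp
  then show False
    using fb by (simp add: mult_le_0_iff)
qed

text \<open>A negative \<open>f\<close> can approach zero at most exponentially, so it does not
  reach zero in finite time. This strict form serves the open stripes, where touching the boundary
  already counts as leaving.\<close>

lemma neg_persists:
  fixes f f' :: "real \<Rightarrow> real"
  assumes "a \<le> b"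
    and der: "\<And>s. s \<in> {a..b} \<Longrightarrow> (f has_vector_derivative f' s) (at s within {a..b})"
    and bound: "\<And>s. s \<in> {a..b} \<Longrightarrow> f' s \<le> K * \<bar>f s\<bar>"
    and "f a < 0"
  shows "f b < 0"
proof (rule ccontr)
  assume fb: "\<not> f b < 0"
  txt \<open>Reversing both the time and the sign of \<open>f\<close> preserves the differential inequality.\<close>
  have "- f (- (- a)) \<le> 0"
  proof (rule nonpos_persists[of "- b" "- a" "\<lambda>s. - f (- s)" "\<lambda>s. f' (- s)" K])
    fix s assume s: "s \<in> {- b..- a}"
    then have "(f has_vector_derivative f' (- s)) (at (- s) within uminus ` {- b..- a})"
      using der[of "- s"] by simp
    moreover have "(uminus has_vector_derivative - 1) (at s within {- b..- a})"
      by (auto intro!: derivative_eq_intros)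
    ultimately have "((f \<circ> uminus) has_vector_derivative - 1 *\<^sub>R f' (- s)) (at s within {- b..- a})"
      by (intro vector_diff_chain_within)
    then show "((\<lambda>s. - f (- s)) has_vector_derivative f' (- s)) (at s within {- b..- a})"
      using has_vector_derivative_minus by (fastforce simp: o_def)
    show "f' (- s) \<le> K * \<bar>- f (- s)\<bar>"
      using bound[of "- s"] s by simp
  qed (use assms fb in auto)
  then show False
    using assms by simp
qed

section \<open>The rotated frame\<close>

text \<open>Coefficient of \<open>u\<close> along \<open>field_V p\<close> in the g-orthonormal
  basis formed by \<open>field_V p\<close> and (sin \<phi>, cos \<phi>); \<open>frame_x\<close> is
  the other coefficient.\<close>

definition frame_t :: "point \<Rightarrow> tangent \<Rightarrow> real" where
  "frame_t p u = cos (phi p) * fst u - sin (phi p) * snd u"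

definition frame_x :: "point \<Rightarrow> tangent \<Rightarrow> real" where
  "frame_x p u = sin (phi p) * fst u + cos (phi p) * snd u"

lemma metric_g_frame: "metric_g p u v = frame_x p u * frame_x p v - frame_t p u * frame_t p v"
  unfolding metric_g_def frame_t_def frame_x_def cos_double sin_double
  by (simp add: algebra_simps power2_eq_square)

lemma frame_inverse:
  "fst u = cos (phi p) * frame_t p u + sin (phi p) * frame_x p u"
  "snd u = cos (phi p) * frame_x p u - sin (phi p) * frame_t p u"
proof -
  \<comment> \<open>The factor cos^2 + sin^2 is kept unevaluated so that both sides expand to the
    same polynomial; it is replaced by 1 only afterwards.\<close>
  have "cos (phi p) * frame_t p u + sin (phi p) * frame_x p u
      = (cos (phi p) * cos (phi p) + sin (phi p) * sin (phi p)) * fst u"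
    and "cos (phi p) * frame_x p u - sin (phi p) * frame_t p u
      = (cos (phi p) * cos (phi p) + sin (phi p) * sin (phi p)) * snd u"
    by (simp_all add: frame_t_def frame_x_def algebra_simps del: sin_cos_squared_add3)
  then show "fst u = cos (phi p) * frame_t p u + sin (phi p) * frame_x p u"
    "snd u = cos (phi p) * frame_x p u - sin (phi p) * frame_t p u"
    by (simp_all only: sin_cos_squared_add3 mult_1_left)
qed

text \<open>The change of frame is also a Euclidean rotation, which lets the coordinate speed
  control the frame coefficients.\<close>

lemma norm_frame: "(norm u)\<^sup>2 = (frame_t p u)\<^sup>2 + (frame_x p u)\<^sup>2"
proof -
  have "(frame_t p u)\<^sup>2 + (frame_x p u)\<^sup>2
      = (cos (phi p) * cos (phi p) + sin (phi p) * sin (phi p)) * ((fst u)\<^sup>2 + (snd u)\<^sup>2)"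
    by (simp add: frame_t_def frame_x_def algebra_simps power2_eq_square del: sin_cos_squared_add3)
  also have "\<dots> = (norm u)\<^sup>2"
    unfolding sin_cos_squared_add3 by (simp add: norm_prod_def)
  finally show ?thesis
    by simp
qed

lemma frame_field_V [simp]: "frame_t p (field_V p) = 1" "frame_x p (field_V p) = 0"
  using sin_cos_squared_add3[of "phi p"]
  by (simp_all add: frame_t_def frame_x_def field_V_def d_t_def d_x_def)

lemma future_directed_frame:
  assumes "future_directed metric_g field_V p u"
  shows "\<bar>frame_x p u\<bar> \<le> frame_t p u"
proof -
  have "(frame_x p u)\<^sup>2 \<le> (frame_t p u)\<^sup>2" "0 \<le> frame_t p u"
    using assms by (simp_all add: future_directed_def causal_def metric_g_frame power2_eq_square)
  then show ?thesis
    using abs_le_square_iff[of "frame_x p u" "frame_t p u"] by simp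
qed

lemma timelike_field_V: "timelike metric_g p (field_V p)"
proof -
  have "field_V p \<noteq> 0"
    using frame_field_V(1)[of p] by (auto simp: frame_t_def)
  then show ?thesis
    by (simp add: timelike_def metric_g_frame)
qed

section \<open>Smoothness of the metric and the Killing equation\<close>

text \<open>The derivative is written in the shape of the function itself, with new coefficients in
  place of \<open>A\<close> and \<open>B\<close>. The family is thus closed under directional
  derivatives, and smoothness follows by induction.\<close>

lemma has_derivative_trig_snd:
  fixes A B :: "'a::real_normed_vector"
  shows "((\<lambda>p::point. cos (w * snd p) *\<^sub>R A + sin (w * snd p) *\<^sub>R B) has_derivative
     (\<lambda>v. cos (w * snd p) *\<^sub>R ((w * snd v) *\<^sub>R B) + sin (w * snd p) *\<^sub>R (- (w * snd v) *\<^sub>R A))) (at p)"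
  by (auto intro!: derivative_eq_intros simp: algebra_simps)

lemma Ck_trig_snd:
  fixes A B :: "'a::real_normed_vector"
  shows "Ck n (\<lambda>p::point. cos (w * snd p) *\<^sub>R A + sin (w * snd p) *\<^sub>R B)"
proof (induction n arbitrary: A B)
  case 0
  show ?case
    by (auto intro!: continuous_intros)
next
  case (Suc n)
  have "Ck n (\<lambda>p::point. cos (w * snd p) *\<^sub>R ((w * snd v) *\<^sub>R B) + sin (w * snd p) *\<^sub>R (- (w * snd v) *\<^sub>R A))"
    for v :: point
    by (rule Suc)
  moreover have "(\<lambda>p::point. cos (w * snd p) *\<^sub>R A + sin (w * snd p) *\<^sub>R B) differentiable (at p)" for p
    unfolding differentiable_def by (rule exI, rule has_derivative_trig_snd)
  ultimately show ?case
    unfolding Ck.simps frechet_derivative_at[OF has_derivative_trig_snd, symmetric] by (intro conjI allI)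
qed

lemma smooth_trig_snd:
  fixes A B :: "'a::real_normed_vector"
  shows "smooth (\<lambda>p::point. cos (w * snd p) *\<^sub>R A + sin (w * snd p) *\<^sub>R B)"
  unfolding smooth_def by (intro allI Ck_trig_snd)

lemma metric_g_trig:
  "(\<lambda>p. metric_g p u v) =
    (\<lambda>p. cos ((2 * pi) * snd p) *\<^sub>R (snd u * snd v - fst u * fst v) +
         sin ((2 * pi) * snd p) *\<^sub>R (fst u * snd v + snd u * fst v))"
  by (simp add: metric_g_def phi_def algebra_simps fun_eq_iff)

lemma lorentzian_metric_g: "lorentzian_metric metric_g"
  unfolding lorentzian_metric_def
proof (intro conjI allI)
  fix p :: point and u v :: tangent
  show "bilinear (metric_g p)"
    by (auto simp: bilinear_def metric_g_def algebra_simps intro!: linearI)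
  show "metric_g p u v = metric_g p v u"
    by (simp add: metric_g_frame)
  show "smooth (\<lambda>p. metric_g p u v)"
    unfolding metric_g_trig by (rule smooth_trig_snd)
  let ?e = "(sin (phi p), cos (phi p)) :: tangent"
  have "frame_t p ?e = 0" "frame_x p ?e = 1"
    using sin_cos_squared_add3[of "phi p"] by (simp_all add: frame_t_def frame_x_def add.commute)
  then show "\<exists>e0 e1. metric_g p e0 e0 = - 1 \<and> metric_g p e1 e1 = 1 \<and> metric_g p e0 e1 = 0"
    by (intro exI[of _ "field_V p"] exI[of _ ?e]) (simp add: metric_g_frame)
qed

lemma smooth_field_V: "smooth field_V"
proof -
  have V: "field_V = (\<lambda>p. cos (pi * snd p) *\<^sub>R (1, 0) + sin (pi * snd p) *\<^sub>R (0, - 1))"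
    by (auto simp: field_V_def d_t_def d_x_def phi_def)
  show ?thesis
    unfolding V by (rule smooth_trig_snd)
qed

text \<open>The coefficients of the metric depend on x alone and \<open>d_t\<close> is constant, so
  all three terms of the Lie derivative vanish.\<close>

lemma killing_field_d_t: "killing_field metric_g d_t"
  unfolding killing_field_def
proof (intro conjI allI)
  have d_t: "d_t = (\<lambda>p. (1, 0))"
    by (simp add: d_t_def fun_eq_iff)
  \<comment> \<open>Frequency 0 makes a constant field a member of the trigonometric family.\<close>
  show "smooth d_t"
    using smooth_trig_snd[of 0 "(1, 0)" 0] unfolding d_t by simp
  fix p u v
  have "frechet_derivative d_t (at p) = (\<lambda>_. 0)"
    unfolding d_t by (rule frechet_derivative_const)
  moreover have "frechet_derivative (\<lambda>q. metric_g q u v) (at p) (d_t p) = 0"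
    unfolding metric_g_trig frechet_derivative_at[OF has_derivative_trig_snd, symmetric]
    by (simp add: d_t_def)
  ultimately show "lie_derivative d_t metric_g p u v = 0"
    by (simp add: lie_derivative_def metric_g_frame frame_t_def frame_x_def)
qed

section \<open>Stripes and their boundary lines\<close>

lemma mem_stripe: "p \<in> stripe k \<longleftrightarrow> of_int k - 1/4 < snd p \<and> snd p < of_int k + 1/4"
  by (cases p) (simp add: stripe_def)

text \<open>The square of \<open>d_t\<close> is -cos(2 pi x), and periodicity reduces the claim to
  cos > 0 on (-pi/2, pi/2).\<close>

lemma timelike_d_t:
  assumes "p \<in> stripe k"
  shows "timelike metric_g p (d_t p)"
proof -
  define y where "y = snd p - of_int k"
  have y: "\<bar>y\<bar> < 1/4"
    using assms unfolding mem_stripe y_def by linarith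
  have phi: "2 * phi p = 2 * pi * y + 2 * pi * of_int k"
    by (simp add: phi_def y_def algebra_simps)
  have "cos (2 * phi p) = cos (2 * pi * y)"
    unfolding phi cos_add cos_int_2pin sin_int_2pin by simp
  moreover have "\<bar>2 * pi * y\<bar> < pi / 2"
    using mult_strict_left_mono[OF y, of "2 * pi"] by (simp add: abs_mult)
  then have "cos (2 * pi * y) > 0"
    by (intro cos_gt_zero_pi) (simp_all only: abs_less_iff minus_less_iff)
  ultimately show ?thesis
    by (simp add: timelike_def metric_g_def d_t_def zero_prod_def)
qed

lemma vertical_line_Times: "vertical_line c = UNIV \<times> {c}"
  by (auto simp: vertical_line_def)

lemma frontier_stripe:
  "frontier (stripe k) = vertical_line (of_int k - 1/4) \<union> vertical_line (of_int k + 1/4)"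
proof -
  have "stripe k = UNIV \<times> {of_int k - 1/4 <..< of_int k + 1/4}"
    by (auto simp: stripe_def)
  then have fr: "frontier (stripe k)
      = UNIV \<times> {of_int k - 1/4 .. of_int k + 1/4} - UNIV \<times> {of_int k - 1/4 <..< of_int k + 1/4}"
    by (simp add: frontier_def closure_Times interior_Times)
  show ?thesis
    unfolding fr vertical_line_Times
    by (rule set_eqI, simp only: Diff_iff Un_iff mem_Times_iff UNIV_I simp_thms
        atLeastAtMost_iff greaterThanLessThan_iff singleton_iff) linarith
qed

text \<open>A connected subset of the union cannot meet both of two disjoint closed pieces, so the
  component of a point is the whole piece containing it.\<close>

lemma components_Un_disjoint_closed:
  assumes "closed A" "closed B" "connected A" "connected B" "A \<inter> B = {}" "A \<noteq> {}" "B \<noteq> {}"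
  shows "components (A \<union> B) = {A, B}"
proof -
  have comp: "connected_component_set (S \<union> T) x = S"
    if "closed S" "closed T" "connected S" "S \<inter> T = {}" "x \<in> S" for S T :: "'a set" and x
  proof
    let ?C = "connected_component_set (S \<union> T) x"
    show "S \<subseteq> ?C"
      using that by (intro connected_component_maximal) auto
    have "x \<in> ?C"
      using that by simp
    then show "?C \<subseteq> S"
      using connected_closedD[of ?C S T] that connected_component_subset[of "S \<union> T" x] by fastforce
  qed
  have "connected_component_set (A \<union> B) x = A" if "x \<in> A" for x
    using comp[of A B x] assms that by blast
  moreover have "connected_component_set (A \<union> B) x = B" if "x \<in> B" for x
    using comp[of B A x] assms that by (simp add: Un_commute Int_commute)
  ultimately show ?thesis
    using assms by (auto simp: components_def image_Un)
qed

lemma components_frontier_stripe: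
  "components (frontier (stripe k)) = {vertical_line (of_int k - 1/4), vertical_line (of_int k + 1/4)}"
  unfolding frontier_stripe
proof (rule components_Un_disjoint_closed)
  have "closed (vertical_line c)" "connected (vertical_line c)" "vertical_line c \<noteq> {}" for c
    unfolding vertical_line_Times by (simp_all add: closed_Times connected_Times)
  then show "closed (vertical_line (of_int k - 1/4))" "closed (vertical_line (of_int k + 1/4))"
    "connected (vertical_line (of_int k - 1/4))" "connected (vertical_line (of_int k + 1/4))"
    "vertical_line (of_int k - 1/4) \<noteq> {}" "vertical_line (of_int k + 1/4) \<noteq> {}"
    by blast+
  show "vertical_line (of_int k - 1/4) \<inter> vertical_line (of_int k + 1/4) = {}"
    by (auto simp: vertical_line_def)
qed

text \<open>Since x is constant along the line, its tangent vectors are multiples of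
  \<open>d_t\<close>, whose square -cos(2 pi c) vanishes there.\<close>

lemma null_vertical_line:
  assumes "cos (2 * pi * c) = 0"
  shows "null_line metric_g (vertical_line c)"
  unfolding null_line_def
proof (intro ballI allI impI)
  fix p u assume p: "p \<in> vertical_line c" and "tangent_to (vertical_line c) p u \<and> u \<noteq> 0"
  then obtain \<gamma> where \<gamma>: "range \<gamma> \<subseteq> vertical_line c" "(\<gamma> has_vector_derivative u) (at 0)" and "u \<noteq> 0"
    unfolding tangent_to_def by blast
  have "((\<lambda>s. snd (\<gamma> s)) has_vector_derivative snd u) (at 0)"
    using bounded_linear.has_vector_derivative[OF bounded_linear_snd \<gamma>(2)] .
  moreover have "snd (\<gamma> s) = c" for s
    using \<gamma>(1) by (auto simp: vertical_line_Times image_subset_iff mem_Times_iff)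
  ultimately have "snd u = 0"
    using vector_derivative_unique_at[OF _ has_vector_derivative_const[of c]] by auto
  moreover have "2 * phi p = 2 * pi * c"
    using p by (auto simp: vertical_line_def phi_def)
  then have "cos (2 * phi p) = 0"
    by (simp only: assms)
  ultimately show "null metric_g p u"
    using \<open>u \<noteq> 0\<close> by (simp add: null_def metric_g_def)
qed

lemma null_components_frontier_stripe:
  assumes "N \<in> components (frontier (stripe k))"
  shows "null_line metric_g N"
proof -
  have "2 * pi * (of_int k - 1/4) = 2 * pi * of_int k - pi/2"
    and "2 * pi * (of_int k + 1/4) = 2 * pi * of_int k + pi/2"
    by (simp_all add: algebra_simps)
  moreover have "cos (2 * pi * of_int k - pi/2) = 0" "cos (2 * pi * of_int k + pi/2) = 0"
    unfolding cos_add cos_diff cos_int_2pin sin_int_2pin by simp_all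
  ultimately have "cos (2 * pi * (of_int k - 1/4)) = 0" "cos (2 * pi * (of_int k + 1/4)) = 0"
    by (simp_all only:)
  then show ?thesis
    using assms null_vertical_line unfolding components_frontier_stripe by blast
qed

section \<open>Vertical lines as one-way barriers\<close>

text \<open>
  The line \<open>x = c\<close> is a barrier against increasing \<open>x\<close> for \<open>\<sigma> = 1\<close> and against decreasing \<open>x\<close>
  for \<open>\<sigma> = -1\<close>.
\<close>

definition barrier :: "real \<Rightarrow> real \<Rightarrow> bool" where
  "barrier \<sigma> c \<longleftrightarrow> \<bar>\<sigma>\<bar> = 1 \<and> \<bar>cos (pi * c)\<bar> \<le> \<sigma> * sin (pi * c)"

text \<open>The barrier condition says that no vector with |Q| \<le> P, placed on the line x = c,
  points in the forbidden direction. Moving away from the line rotates the cone by the angle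
  \<open>y\<close>, which costs at most \<open>norm u\<close> times |y|.\<close>

lemma barrier_velocity:
  assumes "barrier \<sigma> c" and fd: "future_directed metric_g field_V p u"
  shows "\<sigma> * snd u \<le> pi * norm u * \<bar>\<sigma> * (snd p - c)\<bar>"
proof -
  have \<sigma>: "\<bar>\<sigma>\<bar> = 1" and cs: "\<bar>cos (pi * c)\<bar> \<le> \<sigma> * sin (pi * c)"
    using assms by (auto simp: barrier_def)
  define P Q where "P = frame_t p u" and "Q = frame_x p u"
  define y where "y = pi * (snd p - c)"
  have phi: "phi p = pi * c + y"
    by (simp add: phi_def y_def algebra_simps)
  have abs_y: "pi * norm u * \<bar>\<sigma> * (snd p - c)\<bar> = norm u * \<bar>y\<bar>"
    using \<sigma> by (simp add: y_def abs_mult)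
  have PQ: "\<bar>Q\<bar> \<le> P"
    unfolding P_def Q_def by (rule future_directed_frame[OF fd])
  \<comment> \<open>These are the x- and t-components that a vector with frame coefficients
    \<open>P\<close>, \<open>Q\<close> would have on the line x = c; the actual \<open>u\<close>
    arises from them by rotation through \<open>y\<close>.\<close>
  define m n where "m = Q * cos (pi * c) - P * sin (pi * c)"
    and "n = Q * sin (pi * c) + P * cos (pi * c)"
  have snd_u: "snd u = m * cos y - n * sin y"
    unfolding frame_inverse(2)[of u p] phi cos_add sin_add m_def n_def P_def Q_def
    by (simp add: algebra_simps)
  have "m\<^sup>2 + n\<^sup>2 = (cos (pi * c) * cos (pi * c) + sin (pi * c) * sin (pi * c)) * (P\<^sup>2 + Q\<^sup>2)"
    by (simp add: m_def n_def algebra_simps power2_eq_square del: sin_cos_squared_add3)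
  then have "m\<^sup>2 + n\<^sup>2 = (norm u)\<^sup>2"
    by (simp add: sin_cos_squared_add3 norm_frame[of u p] P_def Q_def)
  then have "n\<^sup>2 \<le> (norm u)\<^sup>2"
    by (metis le_add_same_cancel2 zero_le_power2)
  then have n: "\<bar>n\<bar> \<le> norm u"
    using abs_le_square_iff[of n "norm u"] by simp
  have "\<sigma> * (Q * cos (pi * c)) \<le> \<bar>Q\<bar> * \<bar>cos (pi * c)\<bar>"
    using \<sigma> abs_ge_self[of "\<sigma> * (Q * cos (pi * c))"] by (simp add: abs_mult)
  also have "\<dots> \<le> P * (\<sigma> * sin (pi * c))"
    using PQ cs by (intro mult_mono) auto
  finally have m: "\<sigma> * m \<le> 0"
    by (simp add: m_def algebra_simps)
  \<comment> \<open>For cos y \<ge> 0 the term with \<open>m\<close> has the favourable sign and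
    only n sin y remains. Otherwise |y| \<ge> 1, and the trivial bound by \<open>norm u\<close>
    suffices.\<close>
  show ?thesis
  proof (cases "cos y \<ge> 0")
    case True
    have "\<sigma> * snd u = \<sigma> * m * cos y - \<sigma> * n * sin y"
      by (simp add: snd_u algebra_simps)
    also have "\<dots> \<le> \<bar>\<sigma> * n * sin y\<bar>"
      using mult_nonpos_nonneg[OF m True] by linarith
    also have "\<dots> \<le> norm u * \<bar>y\<bar>"
      using n \<sigma> abs_sin_x_le_abs_x[of y] by (simp add: abs_mult mult_mono)
    finally show ?thesis
      by (simp only: abs_y)
  next
    case False
    have "\<bar>y\<bar> \<ge> 1"
    proof (rule ccontr)
      assume "\<not> \<bar>y\<bar> \<ge> 1"
      then have "cos y > 0"
        using pi_gt3 by (intro cos_gt_zero_pi) auto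
      then show False
        using False by simp
    qed
    have "\<sigma> * snd u \<le> \<bar>\<sigma> * snd u\<bar>"
      by simp
    also have "\<dots> \<le> norm u"
      using norm_snd_le[of "snd u" "fst u"] \<sigma> by (simp add: abs_mult)
    also have "\<dots> \<le> norm u * \<bar>y\<bar>"
      using \<open>\<bar>y\<bar> \<ge> 1\<close> by (simp add: mult_le_cancel_left1)
    finally show ?thesis
      by (simp only: abs_y)
  qed
qed

lemma barrier_not_crossed:
  assumes "barrier \<sigma> c"
    and \<gamma>: "future_directed_causal_curve metric_g field_V I \<gamma>"
    and s: "s0 \<in> I" "s1 \<in> I" "s0 \<le> s1"
  shows "\<sigma> * (snd (\<gamma> s0) - c) \<le> 0 \<Longrightarrow> \<sigma> * (snd (\<gamma> s1) - c) \<le> 0"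
    and "\<sigma> * (snd (\<gamma> s0) - c) < 0 \<Longrightarrow> \<sigma> * (snd (\<gamma> s1) - c) < 0"
proof -
  define \<gamma>' where "\<gamma>' = (\<lambda>s. vector_derivative \<gamma> (at s within I))"
  have "is_interval I" and C1: "curve_Ck 1 I \<gamma>"
    and fd: "future_directed metric_g field_V (\<gamma> s) (\<gamma>' s)" if "s \<in> I" for s
    using \<gamma> that by (auto simp: future_directed_causal_curve_def smooth_curve_def \<gamma>'_def)
  then have sub: "{s0..s1} \<subseteq> I"
    using s by (meson atLeastAtMost_iff is_interval_1 subsetI)
  \<comment> \<open>Continuity of the velocity on the compact interval from \<open>s0\<close> to
    \<open>s1\<close> bounds the speed by some \<open>B\<close>, so pi B is a uniform Gronwall
    constant.\<close>
  have "continuous_on I \<gamma>'"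
    using C1 s by (simp add: \<gamma>'_def)
  then have "bounded (\<gamma>' ` {s0..s1})"
    by (intro compact_imp_bounded compact_continuous_image continuous_on_subset[OF _ sub]) auto
  then obtain B where B: "\<And>s. s \<in> {s0..s1} \<Longrightarrow> norm (\<gamma>' s) \<le> B"
    unfolding bounded_iff by blast
  have der: "((\<lambda>s. \<sigma> * (snd (\<gamma> s) - c)) has_vector_derivative \<sigma> * snd (\<gamma>' s)) (at s within {s0..s1})"
    if "s \<in> {s0..s1}" for s
  proof -
    have "\<gamma> differentiable (at s within I)"
      using C1 s sub that by auto
    then have "(\<gamma> has_vector_derivative \<gamma>' s) (at s within {s0..s1})"
      unfolding \<gamma>'_def using sub vector_derivative_works has_vector_derivative_within_subset by blast
    then have "((\<lambda>s. snd (\<gamma> s)) has_vector_derivative snd (\<gamma>' s)) (at s within {s0..s1})"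
      by (rule bounded_linear.has_vector_derivative[OF bounded_linear_snd])
    then show ?thesis
      by (auto intro!: derivative_eq_intros simp flip: has_real_derivative_iff_has_vector_derivative)
  qed
  have bound: "\<sigma> * snd (\<gamma>' s) \<le> (pi * B) * \<bar>\<sigma> * (snd (\<gamma> s) - c)\<bar>" if "s \<in> {s0..s1}" for s
  proof -
    have "\<sigma> * snd (\<gamma>' s) \<le> pi * norm (\<gamma>' s) * \<bar>\<sigma> * (snd (\<gamma> s) - c)\<bar>"
      using sub that by (intro barrier_velocity assms fd) auto
    also have "\<dots> \<le> (pi * B) * \<bar>\<sigma> * (snd (\<gamma> s) - c)\<bar>"
      using B[OF that] by (intro mult_right_mono) auto
    finally show ?thesis .
  qed
  show "\<sigma> * (snd (\<gamma> s0) - c) \<le> 0 \<Longrightarrow> \<sigma> * (snd (\<gamma> s1) - c) \<le> 0"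
    using nonpos_persists[OF s(3) der bound] .
  show "\<sigma> * (snd (\<gamma> s0) - c) < 0 \<Longrightarrow> \<sigma> * (snd (\<gamma> s1) - c) < 0"
    using neg_persists[OF s(3) der bound] .
qed

text \<open>Modulo 2 pi the angles pi c are pi/4, -pi/4, 3 pi/4 and -3 pi/4. There |cos| = |sin|, so
  the barrier condition holds with equality and the sign of the sine fixes the direction.\<close>

lemma barrier_stripe_boundary:
  "barrier 1 (of_int (2 * k) + 1/4)" "barrier (- 1) (of_int (2 * k) - 1/4)"
  "barrier 1 (of_int (2 * k - 1) - 1/4)" "barrier (- 1) (of_int (2 * k - 1) + 1/4)"
proof -
  have arg: "pi * (of_int (2 * k) + 1/4) = 2 * pi * of_int k + pi/4"
    "pi * (of_int (2 * k) - 1/4) = 2 * pi * of_int k - pi/4"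
    "pi * (of_int (2 * k - 1) - 1/4) = 2 * pi * of_int k - (pi + pi/4)"
    "pi * (of_int (2 * k - 1) + 1/4) = 2 * pi * of_int k - (pi - pi/4)"
    by (simp_all add: algebra_simps)
  show "barrier 1 (of_int (2 * k) + 1/4)" "barrier (- 1) (of_int (2 * k) - 1/4)"
    "barrier 1 (of_int (2 * k - 1) - 1/4)" "barrier (- 1) (of_int (2 * k - 1) + 1/4)"
    unfolding barrier_def arg cos_add sin_add cos_diff sin_diff cos_int_2pin sin_int_2pin
    by (simp_all add: sin_45 cos_45)
qed

text \<open>Both edges block outward motion. The stripe is open, so the strict form of the barrier
  property is applied at each edge.\<close>

lemma even_stripe_not_left:
  assumes "future_directed_causal_curve metric_g field_V I \<gamma>"
    and "s0 \<in> I" "s \<in> I" "s0 \<le> s" "\<gamma> s0 \<in> stripe (2 * k)"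
  shows "\<gamma> s \<in> stripe (2 * k)"
  using barrier_not_crossed(2)[OF barrier_stripe_boundary(1) assms(1-4), of k]
    barrier_not_crossed(2)[OF barrier_stripe_boundary(2) assms(1-4), of k] assms(5)
  by (simp add: mem_stripe)

text \<open>Both edges block inward motion. A point outside may lie on an edge, so the non-strict
  form is applied at the edge on whose outer side the curve starts.\<close>

lemma odd_stripe_not_entered:
  assumes "future_directed_causal_curve metric_g field_V I \<gamma>"
    and "s0 \<in> I" "s \<in> I" "s0 \<le> s" "\<gamma> s0 \<notin> stripe (2 * k - 1)"
  shows "\<gamma> s \<notin> stripe (2 * k - 1)"
  using barrier_not_crossed(1)[OF barrier_stripe_boundary(3) assms(1-4), of k]
    barrier_not_crossed(1)[OF barrier_stripe_boundary(4) assms(1-4), of k] assms(5)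
  by (auto simp: mem_stripe)

theorem proposition1p9:
  shows "(lorentzian_metric metric_g) \<and>
    (killing_field metric_g d_t) \<and>
    (\<forall>k. \<forall>p\<in>stripe k. timelike metric_g p (d_t p)) \<and>
    (smooth field_V \<and> (\<forall>p. timelike metric_g p (field_V p))) \<and>
    (\<forall>k. components (frontier (stripe k)) =
             {vertical_line (of_int k - 1/4), vertical_line (of_int k + 1/4)}) \<and>
    (\<forall>k. \<forall>N\<in>components (frontier (stripe k)). null_line metric_g N) \<and>
    (\<forall>k I \<gamma>. future_directed_causal_curve metric_g field_V I \<gamma> \<longrightarrow>
           (\<forall>s0\<in>I. \<gamma> s0 \<in> stripe (2 * k) \<longrightarrow> (\<forall>s\<in>I. s0 \<le> s \<longrightarrow> \<gamma> s \<in> stripe (2 * k)))) \<and>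
    (\<forall>k I \<gamma>. future_directed_causal_curve metric_g field_V I \<gamma> \<longrightarrow>
           (\<forall>s0\<in>I. \<gamma> s0 \<notin> stripe (2 * k - 1) \<longrightarrow>
             (\<forall>s\<in>I. s0 \<le> s \<longrightarrow> \<gamma> s \<notin> stripe (2 * k - 1))))"
  by (intro conjI allI impI ballI)
    (rule lorentzian_metric_g killing_field_d_t timelike_d_t smooth_field_V timelike_field_V
    components_frontier_stripe null_components_frontier_stripe
    even_stripe_not_left odd_stripe_not_entered; assumption)+

end
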